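(* For all $\alpha\in[0,1]$, $m(\alpha)\ge\alpha^4$.
   Context: Piecewise constant functions: $f:[0,1]^3\to[0,1]$ is piecewise constant if there are a positive integer $r$ and real numbers $0=x_0\le x_1\le\dots\le x_r=1$, $0=y_0\le\dots\le y_r=1$, $0=z_0\le\dots\le z_r=1$ such that $f$ is constant on $[x_i,x_{i+1})\times[y_j,y_{j+1})\times[z_k,z_{k+1})$ for all $0\le i,j,k\le r-1$. For such $f$ define $$T(f) = \int_0^1\int_0^1\int_0^1 \left(\int_0^1 f(x,y,z')\,dz'\right)\left(\int_0^1 f(x,y',z)\,dy'\right)\left(\int_0^1 f(x',y,z)\,dx'\right)dx\,dy\,dz,$$ and for $\alpha\in[0,1]$ define $m(\alpha) = \inf_f T(f)$, the infimum over all piecewise constant $f:[0,1]^3\to[0,1]$ with $\int_0^1\int_0^1\int_0^1 f(x,y,z)\,dx\,dy\,dz = \alpha$. *)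

theory Defs
  imports "HOL-Analysis.Analysis"
begin

abbreviation unit_cube :: "(real \<times> real \<times> real) set" where
  "unit_cube \<equiv> {0..1} \<times> {0..1} \<times> {0..1}"

text \<open>
  A function on the unit cube is represented by a total function of which only the values on the
  cube matter. The half-open boxes do not cover the faces on which some coordinate is 1, so there
  the function is only required to take values in the unit interval.
\<close>

definition partition_points :: "nat \<Rightarrow> (nat \<Rightarrow> real) \<Rightarrow> bool" where
  "partition_points r x \<longleftrightarrow> x 0 = 0 \<and> x r = 1 \<and> (\<forall>i<r. x i \<le> x (Suc i))"

definition piecewise_constant :: "(real \<times> real \<times> real \<Rightarrow> real) \<Rightarrow> bool" where
  "piecewise_constant f \<longleftrightarrow>
     f \<in> unit_cube \<rightarrow> {0..1} \<and>
     (\<exists>r x y z. r > 0 \<and> partition_points r x \<and> partition_points r y \<and> partition_points r z \<and>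
        (\<forall>i<r. \<forall>j<r. \<forall>k<r.
           f constant_on ({x i..<x (Suc i)} \<times> {y j..<y (Suc j)} \<times> {z k..<z (Suc k)})))"

text \<open>
  All integrals are Henstock--Kurzweil integrals, which ignore the possibly irregular values on the
  three null faces just mentioned.
\<close>

definition cube_integral :: "(real \<times> real \<times> real \<Rightarrow> real) \<Rightarrow> real" where
  "cube_integral g =
     integral {0..1} (\<lambda>z. integral {0..1} (\<lambda>y. integral {0..1} (\<lambda>x. g (x, y, z))))"

definition T :: "(real \<times> real \<times> real \<Rightarrow> real) \<Rightarrow> real" where
  "T f = cube_integral (\<lambda>(x, y, z).
     integral {0..1} (\<lambda>z'. f (x, y, z')) *
     integral {0..1} (\<lambda>y'. f (x, y', z)) *
     integral {0..1} (\<lambda>x'. f (x', y, z)))"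

text \<open>
  For \<open>\<alpha>\<close> in the unit interval the infimum is over a nonempty set (it contains the value at the
  constant function \<open>\<alpha>\<close>) of nonnegative reals, so \<^const>\<open>Inf\<close> is the true infimum.
\<close>

definition m :: "real \<Rightarrow> real" where
  "m \<alpha> = Inf {T f | f. piecewise_constant f \<and> cube_integral f = \<alpha>}"

end

theory Submission
  imports Defs
begin

text \<open>
  Write \<open>A(x,y)\<close>, \<open>B(x,z)\<close>, \<open>C(y,z)\<close> for the three partial integrals of \<open>f\<close>, so that \<open>T f\<close> is the
  integral of \<open>A B C\<close>. Since \<open>f \<le> 1\<close>, it is enough to bound the integral of \<open>f A B C\<close> from below.
  The product of \<open>A B C\<close>, \<open>1/A\<close>, \<open>1/B\<close> and \<open>1/C\<close> is 1, so Hoelder's inequality with four factors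
  and the weight \<open>f\<close> bounds the fourth power of \<open>\<alpha> = \<integral> f\<close> by the product of \<open>\<integral> f A B C\<close>,
  \<open>\<integral> f/A\<close>, \<open>\<integral> f/B\<close> and \<open>\<integral> f/C\<close>; where a denominator vanishes, so does \<open>f\<close> up to a null set, and
  the quotient is 0. Integrating \<open>f/A\<close> over \<open>z\<close> first gives \<open>A/A \<le> 1\<close>, and
  likewise for \<open>f/B\<close> and \<open>f/C\<close>; hence \<open>\<alpha>\<^sup>4 \<le> T f\<close>.

  Hoelder's inequality is used in its pointwise form, the inequality of arithmetic and geometric
  means with the extremal scaling already inserted: \<open>triforce_amgm\<close>. Since \<open>f\<close> is piecewise
  constant, all integrals are finite weighted sums over the boxes of the partition
  (\<open>cube_integral_step\<close>), which reduces the theorem to the inequality \<open>triforce_sum\<close> about such sums.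
\<close>

section \<open>The inequality for weighted sums\<close>

text \<open>
  The four terms on the right have product 1, so adding up \<open>t \<ge> 1 + ln t\<close> over them makes the
  logarithms cancel. The powers of \<open>\<alpha>\<close> make all four terms equal for \<open>a = b = c = \<alpha>\<close>, which is the
  case of a constant function.
\<close>

lemma triforce_amgm:
  fixes a b c \<alpha> :: real
  assumes "a > 0" "b > 0" "c > 0" "\<alpha> > 0"
  shows "4 \<le> a * b * c / \<alpha> ^ 3 + \<alpha> / a + \<alpha> / b + \<alpha> / c"
proof -
  have *: "1 + ln t \<le> t" if "t > 0" for t :: real
    using ln_le_minus_one[OF that] by simp
  have "1 + ln (a * b * c / \<alpha> ^ 3) \<le> a * b * c / \<alpha> ^ 3" "1 + ln (\<alpha> / a) \<le> \<alpha> / a"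
    "1 + ln (\<alpha> / b) \<le> \<alpha> / b" "1 + ln (\<alpha> / c) \<le> \<alpha> / c"
    using assms by (intro *; simp)+
  moreover have "ln (a * b * c / \<alpha> ^ 3) = ln a + ln b + ln c - 3 * ln \<alpha>"
    using assms by (simp add: ln_div ln_mult ln_realpow)
  ultimately show ?thesis
    using assms by (simp add: ln_div)
qed

text \<open>
  With \<open>A\<close> for the denominator, summing over \<open>k\<close> first leaves \<open>A / A\<close>, which is 1, or 0 where \<open>A\<close>
  vanishes. The index sets play different roles here; permuting them gives the bounds for all three
  marginals.
\<close>

lemma sum_div_marginal_le:
  fixes p :: "'a \<Rightarrow> real" and q :: "'b \<Rightarrow> real" and s :: "'c \<Rightarrow> real"
  assumes p: "\<And>i. i \<in> I \<Longrightarrow> p i \<ge> 0" "sum p I = 1"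
    and q: "\<And>j. j \<in> J \<Longrightarrow> q j \<ge> 0" "sum q J = 1"
  shows "(\<Sum>i\<in>I. \<Sum>j\<in>J. \<Sum>k\<in>K. p i * q j * s k * (F i j k / (\<Sum>l\<in>K. s l * F i j l))) \<le> 1"
proof -
  have "(\<Sum>k\<in>K. p i * q j * s k * (F i j k / (\<Sum>l\<in>K. s l * F i j l))) \<le> p i * q j"
    if "i \<in> I" "j \<in> J" for i j
  proof -
    let ?A = "\<Sum>l\<in>K. s l * F i j l"
    have "(\<Sum>k\<in>K. p i * q j * s k * (F i j k / ?A)) = p i * q j * (?A / ?A)"
      unfolding sum_divide_distrib sum_distrib_left by (rule sum.cong) simp_all
    also have "\<dots> \<le> p i * q j"
      using p(1)[OF that(1)] q(1)[OF that(2)] by (cases "?A = 0") auto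
    finally show ?thesis .
  qed
  then have "(\<Sum>i\<in>I. \<Sum>j\<in>J. \<Sum>k\<in>K. p i * q j * s k * (F i j k / (\<Sum>l\<in>K. s l * F i j l)))
      \<le> (\<Sum>i\<in>I. \<Sum>j\<in>J. p i * q j)"
    by (intro sum_mono)
  also have "\<dots> = 1"
    using p(2) q(2) by (simp flip: sum_product)
  finally show ?thesis .
qed

lemma triforce_sum:
  fixes p :: "'a \<Rightarrow> real" and q :: "'b \<Rightarrow> real" and s :: "'c \<Rightarrow> real"
  assumes fin: "finite I" "finite J" "finite K"
    and p: "\<And>i. i \<in> I \<Longrightarrow> p i \<ge> 0" "sum p I = 1"
    and q: "\<And>j. j \<in> J \<Longrightarrow> q j \<ge> 0" "sum q J = 1"
    and s: "\<And>k. k \<in> K \<Longrightarrow> s k \<ge> 0" "sum s K = 1"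
    and F: "\<And>i j k. \<lbrakk>i \<in> I; j \<in> J; k \<in> K\<rbrakk> \<Longrightarrow> F i j k \<in> {0..1}"
  shows "(\<Sum>i\<in>I. \<Sum>j\<in>J. \<Sum>k\<in>K. p i * q j * s k * F i j k) ^ 4
    \<le> (\<Sum>i\<in>I. \<Sum>j\<in>J. \<Sum>k\<in>K. p i * q j * s k *
          ((\<Sum>l\<in>K. s l * F i j l) * (\<Sum>l\<in>J. q l * F i l k) * (\<Sum>l\<in>I. p l * F l j k)))"
    (is "?\<alpha> ^ 4 \<le> ?T")
proof -
  define A where "A = (\<lambda>i j. \<Sum>l\<in>K. s l * F i j l)"
  define B where "B = (\<lambda>i k. \<Sum>l\<in>J. q l * F i l k)"
  define C where "C = (\<lambda>j k. \<Sum>l\<in>I. p l * F l j k)"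
  have F0: "F i j k \<ge> 0" and F1: "F i j k \<le> 1" if "i \<in> I" "j \<in> J" "k \<in> K" for i j k
    using F[OF that] by auto
  have A0: "A i j \<ge> 0" if "i \<in> I" "j \<in> J" for i j
    unfolding A_def using that F0 s by (intro sum_nonneg mult_nonneg_nonneg) auto
  have B0: "B i k \<ge> 0" if "i \<in> I" "k \<in> K" for i k
    unfolding B_def using that F0 q by (intro sum_nonneg mult_nonneg_nonneg) auto
  have C0: "C j k \<ge> 0" if "j \<in> J" "k \<in> K" for j k
    unfolding C_def using that F0 p by (intro sum_nonneg mult_nonneg_nonneg) auto
  have T: "?T = (\<Sum>i\<in>I. \<Sum>j\<in>J. \<Sum>k\<in>K. p i * q j * s k * (A i j * B i k * C j k))"
    by (simp add: A_def B_def C_def)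
  have T0: "?T \<ge> 0"
    unfolding T using A0 B0 C0 p(1) q(1) s(1) by (intro sum_nonneg mult_nonneg_nonneg) auto
  have \<alpha>0: "?\<alpha> \<ge> 0"
    using F0 p(1) q(1) s(1) by (intro sum_nonneg mult_nonneg_nonneg) auto
  show ?thesis
  proof (cases "?\<alpha> = 0")
    case True
    then show ?thesis using T0 by simp
  next
    case False
    define \<alpha> where "\<alpha> = ?\<alpha>"
    have pos: "\<alpha> > 0"
      using False \<alpha>0 by (simp add: \<alpha>_def)
    define w where "w = (\<lambda>i j k. p i * q j * s k)"
    have pointwise: "4 * (w i j k * F i j k)
        \<le> w i j k * (A i j * B i k * C j k) / \<alpha> ^ 3 + \<alpha> * (w i j k * (F i j k / A i j))
          + \<alpha> * (w i j k * (F i j k / B i k)) + \<alpha> * (w i j k * (F i j k / C j k))"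
      if ijk: "i \<in> I" "j \<in> J" "k \<in> K" for i j k
    proof (cases "w i j k * F i j k = 0")
      case True
      then have "w i j k = 0 \<or> F i j k = 0"
        by simp
      moreover have "0 \<le> w i j k"
        using ijk p(1) q(1) s(1) by (simp add: w_def)
      ultimately show ?thesis
        using A0[OF ijk(1,2)] B0[OF ijk(1,3)] C0[OF ijk(2,3)] pos by auto
    next
      case False
      have "0 < p i" "0 < q j" "0 < s k" "0 < F i j k"
        using False ijk p(1) q(1) s(1) F0[OF ijk] by (auto simp: w_def less_le)
      then have w: "0 < w i j k" and Fp: "0 < F i j k"
        by (auto simp: w_def)
      \<comment> \<open>Each marginal sum contains a positive multiple of \<open>F i j k\<close>.\<close>
      have "A i j > 0"
        unfolding A_def using ijk fin s(1) F0 \<open>0 < s k\<close> Fp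
        by (intro sum_pos2[of _ k]) auto
      moreover have "B i k > 0"
        unfolding B_def using ijk fin q(1) F0 \<open>0 < q j\<close> Fp
        by (intro sum_pos2[of _ j]) auto
      moreover have "C j k > 0"
        unfolding C_def using ijk fin p(1) F0 \<open>0 < p i\<close> Fp
        by (intro sum_pos2[of _ i]) auto
      ultimately have "4 \<le> A i j * B i k * C j k / \<alpha> ^ 3 + \<alpha> / A i j + \<alpha> / B i k + \<alpha> / C j k"
        and ABC: "0 < A i j * B i k * C j k"
        using pos by (auto intro: triforce_amgm)
      then have "w i j k * F i j k * 4 \<le> w i j k * F i j k *
          (A i j * B i k * C j k / \<alpha> ^ 3 + \<alpha> / A i j + \<alpha> / B i k + \<alpha> / C j k)"
        using w Fp by (intro mult_left_mono) auto
      moreover have "F i j k * (w i j k * (A i j * B i k * C j k) / \<alpha> ^ 3)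
          \<le> 1 * (w i j k * (A i j * B i k * C j k) / \<alpha> ^ 3)"
        using F1[OF ijk] w ABC pos by (intro mult_right_mono) auto
      ultimately show ?thesis
        by (simp add: algebra_simps)
    qed
    have "4 * \<alpha> = (\<Sum>i\<in>I. \<Sum>j\<in>J. \<Sum>k\<in>K. 4 * (w i j k * F i j k))"
      by (simp add: \<alpha>_def w_def sum_distrib_left)
    also have "\<dots> \<le> (\<Sum>i\<in>I. \<Sum>j\<in>J. \<Sum>k\<in>K.
          w i j k * (A i j * B i k * C j k) / \<alpha> ^ 3 + \<alpha> * (w i j k * (F i j k / A i j))
          + \<alpha> * (w i j k * (F i j k / B i k)) + \<alpha> * (w i j k * (F i j k / C j k)))"
      using pointwise by (intro sum_mono)
    also have "\<dots> = ?T / \<alpha> ^ 3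
        + \<alpha> * (\<Sum>i\<in>I. \<Sum>j\<in>J. \<Sum>k\<in>K. w i j k * (F i j k / A i j))
        + \<alpha> * (\<Sum>i\<in>I. \<Sum>j\<in>J. \<Sum>k\<in>K. w i j k * (F i j k / B i k))
        + \<alpha> * (\<Sum>i\<in>I. \<Sum>j\<in>J. \<Sum>k\<in>K. w i j k * (F i j k / C j k))"
      unfolding T w_def by (simp only: sum.distrib sum_distrib_left sum_divide_distrib)
    also have "\<dots> \<le> ?T / \<alpha> ^ 3 + \<alpha> * 1 + \<alpha> * 1 + \<alpha> * 1"
    proof (intro add_mono mult_left_mono order_refl)
      show "(\<Sum>i\<in>I. \<Sum>j\<in>J. \<Sum>k\<in>K. w i j k * (F i j k / A i j)) \<le> 1"
        unfolding w_def A_def using p q by (intro sum_div_marginal_le)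
      have "(\<Sum>i\<in>I. \<Sum>j\<in>J. \<Sum>k\<in>K. w i j k * (F i j k / B i k))
          = (\<Sum>i\<in>I. \<Sum>k\<in>K. \<Sum>j\<in>J. p i * s k * q j * (F i j k / B i k))"
        by (subst (2) sum.swap) (simp add: w_def mult_ac)
      also have "\<dots> \<le> 1"
        unfolding B_def using p s by (intro sum_div_marginal_le)
      finally show "(\<Sum>i\<in>I. \<Sum>j\<in>J. \<Sum>k\<in>K. w i j k * (F i j k / B i k)) \<le> 1" .
      have "(\<Sum>i\<in>I. \<Sum>j\<in>J. \<Sum>k\<in>K. w i j k * (F i j k / C j k))
          = (\<Sum>j\<in>J. \<Sum>i\<in>I. \<Sum>k\<in>K. w i j k * (F i j k / C j k))"
        by (rule sum.swap)
      also have "\<dots> = (\<Sum>j\<in>J. \<Sum>k\<in>K. \<Sum>i\<in>I. q j * s k * p i * (F i j k / C j k))"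
        by (subst (2) sum.swap) (simp add: w_def mult_ac)
      also have "\<dots> \<le> 1"
        unfolding C_def using q s by (intro sum_div_marginal_le)
      finally show "(\<Sum>i\<in>I. \<Sum>j\<in>J. \<Sum>k\<in>K. w i j k * (F i j k / C j k)) \<le> 1" .
    qed (use pos in auto)
    finally have "\<alpha> \<le> ?T / \<alpha> ^ 3"
      by simp
    then have "\<alpha> * \<alpha> ^ 3 \<le> ?T"
      using pos by (simp add: pos_le_divide_eq)
    then show ?thesis
      unfolding \<alpha>_def[symmetric] by (simp add: numeral_eq_Suc)
  qed
qed

section \<open>Integrals of step functions\<close>

lemma partition_points_le:
  assumes "partition_points r x" "i \<le> j" "j \<le> r"
  shows "x i \<le> x j"
  using assms(2,3)
proof (induction j rule: dec_induct)
  case (step j)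
  then show ?case
    using assms(1) unfolding partition_points_def by (meson Suc_leD Suc_le_lessD order_trans)
qed simp

lemma partition_points_mem:
  assumes "partition_points r x" "i \<le> r"
  shows "x i \<in> {0..1}"
  using partition_points_le[OF assms(1), of 0 i] partition_points_le[OF assms(1), of i r] assms
  by (simp add: partition_points_def)

lemma partition_points_sum:
  assumes "partition_points r x"
  shows "(\<Sum>i<r. x (Suc i) - x i) = 1"
  using assms by (simp add: sum_lessThan_telescope partition_points_def)

text \<open>
  Nothing is known about the value at 1, which lies in no half-open interval; it does not affect the
  integral.
\<close>

lemma has_integral_step:
  fixes g :: "real \<Rightarrow> real"
  assumes x: "partition_points r x"
    and g: "\<And>i t. \<lbrakk>i < r; t \<in> {x i..<x (Suc i)}\<rbrakk> \<Longrightarrow> g t = c i"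
  shows "(g has_integral (\<Sum>i<r. (x (Suc i) - x i) * c i)) {0..1}"
proof -
  have "(g has_integral (\<Sum>i<n. (x (Suc i) - x i) * c i)) {x 0..x n}" if "n \<le> r" for n
    using that
  proof (induction n)
    case 0
    then show ?case
      using has_integral_refl(2)[of g "x 0"] by simp
  next
    case (Suc n)
    have le: "x 0 \<le> x n" "x n \<le> x (Suc n)"
      using Suc.prems by (auto intro!: partition_points_le[OF x])
    have "((\<lambda>_. c n) has_integral (x (Suc n) - x n) * c n) {x n..x (Suc n)}"
      using has_integral_const_real[of "c n" "x n" "x (Suc n)"] le by simp
    then have "(g has_integral (x (Suc n) - x n) * c n) {x n..x (Suc n)}"
      using g[of n] Suc.prems
      by (intro has_integral_spike_finite[of "{x (Suc n)}" _ g "\<lambda>_. c n"]) auto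
    then have "(g has_integral (\<Sum>i<n. (x (Suc i) - x i) * c i) + (x (Suc n) - x n) * c n)
        {x 0..x (Suc n)}"
      using Suc by (intro has_integral_combine[OF le]) auto
    then show ?case
      by simp
  qed
  from this[of r] show ?thesis
    using x by (simp add: partition_points_def)
qed

lemmas integral_step = integral_unique[OF has_integral_step]

lemma cube_integral_step:
  assumes "partition_points r x" "partition_points r y" "partition_points r z"
    and g: "\<And>i j k s t u. \<lbrakk>i < r; j < r; k < r; s \<in> {x i..<x (Suc i)};
        t \<in> {y j..<y (Suc j)}; u \<in> {z k..<z (Suc k)}\<rbrakk> \<Longrightarrow> g (s, t, u) = G i j k"
  shows "cube_integral g = (\<Sum>i<r. \<Sum>j<r. \<Sum>k<r.
    (x (Suc i) - x i) * (y (Suc j) - y j) * (z (Suc k) - z k) * G i j k)"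
proof -
  have "cube_integral g = (\<Sum>k<r. (z (Suc k) - z k) * (\<Sum>j<r. (y (Suc j) - y j) *
      (\<Sum>i<r. (x (Suc i) - x i) * G i j k)))"
    unfolding cube_integral_def using assms(1-3) by (intro integral_step g)
  also have "\<dots> = (\<Sum>k<r. \<Sum>j<r. \<Sum>i<r.
      (x (Suc i) - x i) * (y (Suc j) - y j) * (z (Suc k) - z k) * G i j k)"
    by (simp add: sum_distrib_left mult_ac)
  also have "\<dots> = (\<Sum>j<r. \<Sum>i<r. \<Sum>k<r.
      (x (Suc i) - x i) * (y (Suc j) - y j) * (z (Suc k) - z k) * G i j k)"
    by (subst sum.swap, subst (2) sum.swap) (rule refl)
  also have "\<dots> = (\<Sum>i<r. \<Sum>j<r. \<Sum>k<r.
      (x (Suc i) - x i) * (y (Suc j) - y j) * (z (Suc k) - z k) * G i j k)"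
    by (rule sum.swap)
  finally show ?thesis .
qed

section \<open>The lower bound\<close>

lemma T_ge:
  assumes "piecewise_constant f"
  shows "cube_integral f ^ 4 \<le> T f"
proof -
  obtain r x y z where x: "partition_points r x" and y: "partition_points r y"
    and z: "partition_points r z"
    and const: "\<And>i j k. \<lbrakk>i < r; j < r; k < r\<rbrakk> \<Longrightarrow>
        f constant_on ({x i..<x (Suc i)} \<times> {y j..<y (Suc j)} \<times> {z k..<z (Suc k)})"
    and range: "f \<in> unit_cube \<rightarrow> {0..1}"
    using assms unfolding piecewise_constant_def by metis
  \<comment> \<open>If a box is empty, its corner need not belong to it, but it still lies in the cube.\<close>
  define F where "F = (\<lambda>i j k. f (x i, y j, z k))"
  have F: "F i j k \<in> {0..1}" if "i \<in> {..<r}" "j \<in> {..<r}" "k \<in> {..<r}" for i j k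
    unfolding F_def
    using that partition_points_mem[OF x, of i] partition_points_mem[OF y, of j]
      partition_points_mem[OF z, of k] by (intro funcset_mem[OF range]) auto
  have f: "f (s, t, u) = F i j k"
    if "i < r" "j < r" "k < r" "s \<in> {x i..<x (Suc i)}" "t \<in> {y j..<y (Suc j)}"
      "u \<in> {z k..<z (Suc k)}" for i j k s t u
    using const[OF that(1-3)] that(4-6) unfolding F_def constant_on_def by force
  have w: "x (Suc i) - x i \<ge> 0" "y (Suc i) - y i \<ge> 0" "z (Suc i) - z i \<ge> 0"
    if "i \<in> {..<r}" for i
    using that x y z by (auto simp: partition_points_def)
  have "T f = (\<Sum>i<r. \<Sum>j<r. \<Sum>k<r.
      (x (Suc i) - x i) * (y (Suc j) - y j) * (z (Suc k) - z k) *
      ((\<Sum>l<r. (z (Suc l) - z l) * F i j l) * (\<Sum>l<r. (y (Suc l) - y l) * F i l k)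
        * (\<Sum>l<r. (x (Suc l) - x l) * F l j k)))"
    unfolding T_def
  proof (intro cube_integral_step x y z)
    fix i j k s t u
    assume *: "i < r" "j < r" "k < r" "s \<in> {x i..<x (Suc i)}" "t \<in> {y j..<y (Suc j)}"
      "u \<in> {z k..<z (Suc k)}"
    have "integral {0..1} (\<lambda>z'. f (s, t, z')) = (\<Sum>l<r. (z (Suc l) - z l) * F i j l)"
      using * by (intro integral_step z f)
    moreover have "integral {0..1} (\<lambda>y'. f (s, y', u)) = (\<Sum>l<r. (y (Suc l) - y l) * F i l k)"
      using * by (intro integral_step y f)
    moreover have "integral {0..1} (\<lambda>x'. f (x', t, u)) = (\<Sum>l<r. (x (Suc l) - x l) * F l j k)"
      using * by (intro integral_step x f)
    ultimately show "(case (s, t, u) of (x, y, z) \<Rightarrow>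
        integral {0..1} (\<lambda>z'. f (x, y, z')) * integral {0..1} (\<lambda>y'. f (x, y', z)) *
        integral {0..1} (\<lambda>x'. f (x', y, z)))
      = (\<Sum>l<r. (z (Suc l) - z l) * F i j l) * (\<Sum>l<r. (y (Suc l) - y l) * F i l k)
        * (\<Sum>l<r. (x (Suc l) - x l) * F l j k)"
      by simp
  qed
  moreover have "cube_integral f = (\<Sum>i<r. \<Sum>j<r. \<Sum>k<r.
      (x (Suc i) - x i) * (y (Suc j) - y j) * (z (Suc k) - z k) * F i j k)"
    by (intro cube_integral_step x y z f)
  ultimately show ?thesis
    using w F x y z by (simp only:) (intro triforce_sum partition_points_sum finite_lessThan; simp)
qed

lemma piecewise_constant_const:
  assumes "\<alpha> \<in> {0..1}"
  shows "piecewise_constant (\<lambda>_. \<alpha>)"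
proof -
  have "partition_points 1 real"
    by (simp add: partition_points_def)
  then show ?thesis
    using assms unfolding piecewise_constant_def constant_on_def
    by (intro conjI exI[of _ 1] exI[of _ real]) auto
qed

text \<open>
  In the type of reals the infimum of the empty set is unspecified, so a lower bound for all \<open>T f\<close>
  is one for \<open>m \<alpha>\<close> only because the constant function \<open>\<alpha>\<close> has integral \<open>\<alpha>\<close>.
\<close>

theorem mainTheorem4:
  fixes \<alpha> :: real
  assumes "\<alpha> \<in> {0..1}"
  shows "m \<alpha> \<ge> \<alpha> ^ 4"
  unfolding m_def
proof (rule cInf_greatest)
  have "cube_integral (\<lambda>_. \<alpha>) = \<alpha>"
    by (simp add: cube_integral_def)
  then show "{T f |f. piecewise_constant f \<and> cube_integral f = \<alpha>} \<noteq> {}"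
    using piecewise_constant_const[OF assms] by blast
next
  fix t
  assume "t \<in> {T f |f. piecewise_constant f \<and> cube_integral f = \<alpha>}"
  then show "\<alpha> ^ 4 \<le> t"
    using T_ge by blast
qed

end
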